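(* Let $\mathcal{A}\in\mathbb{C}^{I_1\times\cdots\times I_N\times J_1\times\cdots\times J_N}$ and $\mathcal{B}\in\mathbb{C}^{J_1\times\cdots\times J_N\times I_1\times\cdots\times I_N}$. Then $(\mathcal{A}*_N\mathcal{B})^{\dagger}=\mathcal{B}^{\dagger}*_N\mathcal{A}^{\dagger}$ if and only if $$\mathcal{A}^{\dagger}*_N\mathcal{A}*_N\mathcal{B}*_N\mathcal{B}^**_N\mathcal{A}^**_N\mathcal{A}*_N\mathcal{B}*_N\mathcal{B}^{\dagger}=\mathcal{B}*_N\mathcal{B}^**_N\mathcal{A}^**_N\mathcal{A}.$$
   Context: Tensors are complex multiway arrays, with entries of $\mathcal{A}\in\mathbb{C}^{I_1\times\cdots\times I_N\times J_1\times\cdots\times J_N}$ denoted $a_{i_1\ldots i_N j_1\ldots j_N}$. The Einstein product of $\mathcal{A}\in\mathbb{C}^{I_1\times\cdots\times I_N\times K_1\times\cdots\times K_N}$ and $\mathcal{B}\in\mathbb{C}^{K_1\times\cdots\times K_N\times J_1\times\cdots\times J_M}$ is the tensor $\mathcal{A}*_N\mathcal{B}\in\mathbb{C}^{I_1\times\cdots\times I_N\times J_1\times\cdots\times J_M}$ with $(\mathcal{A}*_N\mathcal{B})_{i_1\ldots i_N j_1\ldots j_M}=\sum_{k_1\ldots k_N}a_{i_1\ldots i_N k_1\ldots k_N}b_{k_1\ldots k_N j_1\ldots j_M}$; it is associative. The conjugate transpose $\mathcal{A}^*\in\mathbb{C}^{J_1\times\cdots\times J_N\times I_1\times\cdots\times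 I_N}$ has entries $(\mathcal{A}^* )_{j_1\ldots j_N i_1\ldots i_N}=\overline{a_{i_1\ldots i_N j_1\ldots j_N}}$. The Moore-Penrose inverse $\mathcal{A}^{\dagger}$ of $\mathcal{A}\in\mathbb{C}^{I_1\times\cdots\times I_N\times J_1\times\cdots\times J_N}$ is the unique tensor $\mathcal{X}\in\mathbb{C}^{J_1\times\cdots\times J_N\times I_1\times\cdots\times I_N}$ (it always exists) satisfying (1) $\mathcal{A}*_N\mathcal{X}*_N\mathcal{A}=\mathcal{A}$; (2) $\mathcal{X}*_N\mathcal{A}*_N\mathcal{X}=\mathcal{X}$; (3) $(\mathcal{A}*_N\mathcal{X})^*=\mathcal{A}*_N\mathcal{X}$; (4) $(\mathcal{X}*_N\mathcal{A})^*=\mathcal{X}*_N\mathcal{A}$. *)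

theory Defs
  imports Complex_Main
begin

definition idx :: "nat list \<Rightarrow> nat list set" where
  "idx ds = {is. list_all2 (<) is ds}"

text \<open>
  A tensor carries its list of dimensions and its entries, addressed by multi-indices counted
  from 0. Entries outside the index range are normalised to 0, so that equality of tensors
  is equality of the dimensions and of all entries.
\<close>

typedef tensor = "{(ds :: nat list, a :: nat list \<Rightarrow> complex). \<forall>is. is \<notin> idx ds \<longrightarrow> a is = 0}"
  by (rule exI[of _ "([], \<lambda>_. 0)"]) auto

definition dims :: "tensor \<Rightarrow> nat list" where
  "dims A = fst (Rep_tensor A)"

definition entry :: "tensor \<Rightarrow> nat list \<Rightarrow> complex" where
  "entry A = snd (Rep_tensor A)"

definition mk_tensor :: "nat list \<Rightarrow> (nat list \<Rightarrow> complex) \<Rightarrow> tensor" where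
  "mk_tensor ds a = Abs_tensor (ds, \<lambda>is. if is \<in> idx ds then a is else 0)"

definition tensors :: "nat list \<Rightarrow> tensor set" where
  "tensors ds = {A. dims A = ds}"

lemma dims_mk_tensor [simp]: "dims (mk_tensor ds a) = ds"
  by (simp add: dims_def mk_tensor_def Abs_tensor_inverse)

lemma entry_mk_tensor: "entry (mk_tensor ds a) is = (if is \<in> idx ds then a is else 0)"
  by (simp add: entry_def mk_tensor_def Abs_tensor_inverse)

lemma tensor_eqI:
  assumes "dims A = dims B" and "\<And>is. is \<in> idx (dims A) \<Longrightarrow> entry A is = entry B is"
  shows "A = B"
proof -
  have "entry A is = entry B is" for "is"
    using assms Rep_tensor[of A] Rep_tensor[of B]
    by (cases "is \<in> idx (dims A)") (auto simp: dims_def entry_def split: prod.splits)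
  then have "Rep_tensor A = Rep_tensor B"
    using assms(1) by (auto simp: dims_def entry_def prod_eq_iff)
  then show ?thesis
    by (simp add: Rep_tensor_inject)
qed

text \<open>
  In \<open>A \<star>\<^bsub>N\<^esub> B\<close> the left factor has order 2N, its last N dimensions being the first N
  dimensions of B; the order N + M of B is unrestricted.
\<close>

definition einstein :: "tensor \<Rightarrow> nat \<Rightarrow> tensor \<Rightarrow> tensor"
    (\<open>(_ \<star>\<^bsub>_\<^esub> _)\<close> [70, 0, 71] 70) where
  "A \<star>\<^bsub>N\<^esub> B = mk_tensor (take N (dims A) @ drop N (dims B))
     (\<lambda>ij. \<Sum>k\<in>idx (drop N (dims A)). entry A (take N ij @ k) * entry B (k @ drop N ij))"

text \<open>
  The conjugate transpose and the Moore-Penrose inverse are meant for tensors of order 2N, whose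
  first N dimensions are the row dimensions and whose last N are the column dimensions.
\<close>

definition ctranspose :: "nat \<Rightarrow> tensor \<Rightarrow> tensor" where
  "ctranspose N A = mk_tensor (drop N (dims A) @ take N (dims A))
     (\<lambda>ji. cnj (entry A (drop N ji @ take N ji)))"

definition is_mp_inverse :: "nat \<Rightarrow> tensor \<Rightarrow> tensor \<Rightarrow> bool" where
  "is_mp_inverse N A X \<longleftrightarrow>
     X \<in> tensors (drop N (dims A) @ take N (dims A)) \<and>
     A \<star>\<^bsub>N\<^esub> X \<star>\<^bsub>N\<^esub> A = A \<and>
     X \<star>\<^bsub>N\<^esub> A \<star>\<^bsub>N\<^esub> X = X \<and>
     ctranspose N (A \<star>\<^bsub>N\<^esub> X) = A \<star>\<^bsub>N\<^esub> X \<and>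
     ctranspose N (X \<star>\<^bsub>N\<^esub> A) = X \<star>\<^bsub>N\<^esub> A"

definition mp_inverse :: "nat \<Rightarrow> tensor \<Rightarrow> tensor" where
  "mp_inverse N A = (THE X. is_mp_inverse N A X)"

end

theory Submission
  imports Defs
begin

text \<open>
  Write \<open>x = a\<^sup>\<dagger>\<close>, \<open>y = b\<^sup>\<dagger>\<close>, \<open>M = b b\<^sup>H\<close>, \<open>K = a\<^sup>H a\<close> and let \<open>P = x a\<close>, \<open>Q = b y\<close> be the
  orthogonal projections onto the row space of \<open>a\<close> and the column space of \<open>b\<close>. The condition of
  the theorem reads \<open>P M K Q = M K\<close>. As \<open>P\<close> and \<open>Q\<close> are idempotent it splits into \<open>P M K = M K\<close>
  and \<open>M K Q = M K\<close>, and cancelling \<open>a\<close> on the right of the first and \<open>b\<close> on the left of the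
  second, whose adjoint is then taken, turns these into Greville's two conditions
  \<open>P M a\<^sup>H = M a\<^sup>H\<close> and \<open>Q K b = K b\<close>.

  Greville's conditions characterise \<open>(a b)\<^sup>\<dagger> = y x\<close>. If the reverse order law holds, then
  \<open>u = M a\<^sup>H\<close> and \<open>P u\<close> satisfy \<open>u\<^sup>H u = u\<^sup>H P u\<close>, so the difference \<open>u - P u\<close> has Gram tensor zero and
  vanishes; the second condition is the first one for the adjoint product \<open>b\<^sup>H a\<^sup>H\<close>. Conversely,
  the conditions make \<open>P\<close> commute with \<open>M\<close> and \<open>Q\<close> commute with \<open>K\<close>, hence \<open>P\<close> commute with \<open>Q\<close>,
  and then the four Penrose equations for \<open>a b\<close> and \<open>y x\<close> can be verified directly
  (\<open>reverse_order_iff_invariant\<close>).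

  This argument is purely multiplicative. It takes place in an involutive semigroup with two
  additional properties (locale \<open>adjoint_semigroup\<close>): definiteness of the Gram element \<open>x\<^sup>H x\<close> and
  solvability of the normal equations, from which Moore-Penrose inverses are built. For tensors
  definiteness is positivity of a sum of squared moduli, and the normal equations are solved by
  orthogonalising the columns one at a time (\<open>normal_equations_solvable\<close>).

  The tensors of order \<open>2N\<close> form such a semigroup for all choices of dimensions at once: when the
  inner dimensions of two factors disagree, the entries addressed outside a factor are 0, and this
  is enough for associativity and for the adjoint of a product. Equations between products
  can therefore be handled with a single associativity law.
\<close>

section \<open>Moore-Penrose inverses in semigroups with involution\<close>

text \<open>
  The last two assumptions carry the linear algebra. \<open>proper\<close> expresses
  \<open>(x - y)\<^sup>H (x - y) = 0 \<Longrightarrow> x = y\<close> without subtraction; the fourth product \<open>y\<^sup>H x\<close> is the adjoint of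
  \<open>x\<^sup>H y\<close>. The map \<open>rows\<close> is there because padding a tensor with rows of zeros preserves all four
  products, so \<open>x = y\<close> can be expected only when the row dimensions agree. \<open>normal_equation\<close> says
  that the least squares problem with coefficients \<open>x\<close> is solvable for every right-hand side.
\<close>

locale adjoint_semigroup =
  fixes S :: "'a set"
    and mult :: "'a \<Rightarrow> 'a \<Rightarrow> 'a"  (infixl \<open>\<cdot>\<close> 70)
    and adj :: "'a \<Rightarrow> 'a"  (\<open>_\<^sup>H\<close> [1000] 1000)
    and rows :: "'a \<Rightarrow> 'd"
  assumes mult_closed [simp]: "\<lbrakk>x \<in> S; y \<in> S\<rbrakk> \<Longrightarrow> x \<cdot> y \<in> S"
    and adj_closed [simp]: "x \<in> S \<Longrightarrow> x\<^sup>H \<in> S"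
    and assoc: "\<lbrakk>x \<in> S; y \<in> S; z \<in> S\<rbrakk> \<Longrightarrow> x \<cdot> y \<cdot> z = x \<cdot> (y \<cdot> z)"
    and adj_adj [simp]: "x \<in> S \<Longrightarrow> x\<^sup>H\<^sup>H = x"
    and adj_mult [simp]: "\<lbrakk>x \<in> S; y \<in> S\<rbrakk> \<Longrightarrow> (x \<cdot> y)\<^sup>H = y\<^sup>H \<cdot> x\<^sup>H"
    and rows_mult [simp]: "\<lbrakk>x \<in> S; y \<in> S\<rbrakk> \<Longrightarrow> rows (x \<cdot> y) = rows x"
    and proper: "\<lbrakk>x \<in> S; y \<in> S; rows x = rows y; x\<^sup>H \<cdot> x = x\<^sup>H \<cdot> y; y\<^sup>H \<cdot> y = x\<^sup>H \<cdot> y\<rbrakk> \<Longrightarrow> x = y"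
    and normal_equation: "x \<in> S \<Longrightarrow> \<exists>g\<in>S. x\<^sup>H \<cdot> (x \<cdot> g) = x\<^sup>H"
begin

definition mp :: "'a \<Rightarrow> 'a \<Rightarrow> bool" where
  "mp a x \<longleftrightarrow> x \<in> S \<and> a \<cdot> x \<cdot> a = a \<and> x \<cdot> a \<cdot> x = x
     \<and> (a \<cdot> x)\<^sup>H = a \<cdot> x \<and> (x \<cdot> a)\<^sup>H = x \<cdot> a"

lemma mp_unique:
  assumes a: "a \<in> S" and x: "mp a x" and y: "mp a y"
  shows "x = y"
proof -
  note S = a x[unfolded mp_def, THEN conjunct1] y[unfolded mp_def, THEN conjunct1]
  have ax: "a \<cdot> x = a \<cdot> y"
  proof -
    have "a \<cdot> x = (a \<cdot> y \<cdot> a \<cdot> x)\<^sup>H"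
      using x y by (simp add: mp_def)
    also have "\<dots> = (a \<cdot> x)\<^sup>H \<cdot> (a \<cdot> y)\<^sup>H"
      using S by (simp add: assoc)
    also have "\<dots> = a \<cdot> x \<cdot> (a \<cdot> y)"
      using x y by (simp only: mp_def)
    also have "\<dots> = a \<cdot> x \<cdot> a \<cdot> y"
      using S by (simp add: assoc)
    also have "\<dots> = a \<cdot> y"
      using x by (simp add: mp_def)
    finally show ?thesis .
  qed
  have xa: "x \<cdot> a = y \<cdot> a"
  proof -
    have "x \<cdot> a = (x \<cdot> (a \<cdot> y \<cdot> a))\<^sup>H"
      using x y by (simp add: mp_def)
    also have "\<dots> = (y \<cdot> a)\<^sup>H \<cdot> (x \<cdot> a)\<^sup>H"
      using S by (simp add: assoc)
    also have "\<dots> = y \<cdot> a \<cdot> (x \<cdot> a)"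
      using x y by (simp only: mp_def)
    also have "\<dots> = y \<cdot> (a \<cdot> x \<cdot> a)"
      using S by (simp add: assoc)
    also have "\<dots> = y \<cdot> a"
      using x by (simp add: mp_def)
    finally show ?thesis .
  qed
  have "x = x \<cdot> a \<cdot> x"
    using x by (simp add: mp_def)
  also have "\<dots> = y \<cdot> (a \<cdot> x)"
    using S by (simp add: xa assoc)
  also have "\<dots> = y \<cdot> a \<cdot> y"
    using S by (simp add: ax assoc)
  also have "\<dots> = y"
    using y by (simp add: mp_def)
  finally show ?thesis .
qed

text \<open>
  A solution \<open>g\<close> of the normal equations \<open>a\<^sup>H a g = a\<^sup>H\<close> has adjoint \<open>g\<^sup>H a\<^sup>H a = a\<close>. So
  \<open>(a g)\<^sup>H = g\<^sup>H a\<^sup>H = g\<^sup>H a\<^sup>H a g = a g\<close>, and \<open>a g a = (a g)\<^sup>H a = a\<close>.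
\<close>

lemma least_squares_inverse:
  assumes a: "a \<in> S"
  obtains g where "g \<in> S" "a \<cdot> g \<cdot> a = a" "(a \<cdot> g)\<^sup>H = a \<cdot> g"
proof -
  obtain g where g: "g \<in> S" and e: "a\<^sup>H \<cdot> (a \<cdot> g) = a\<^sup>H"
    using normal_equation[OF a] by blast
  have e': "g\<^sup>H \<cdot> a\<^sup>H \<cdot> a = a"
    using arg_cong[OF e, of adj] a g by (simp add: assoc)
  have "(a \<cdot> g)\<^sup>H = g\<^sup>H \<cdot> (a\<^sup>H \<cdot> (a \<cdot> g))"
    using a g e by simp
  also have "\<dots> = g\<^sup>H \<cdot> a\<^sup>H \<cdot> a \<cdot> g"
    using a g by (simp add: assoc)
  finally have h: "(a \<cdot> g)\<^sup>H = a \<cdot> g"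
    by (simp only: e')
  have "a \<cdot> g \<cdot> a = (a \<cdot> g)\<^sup>H \<cdot> a"
    by (simp only: h)
  also have "\<dots> = a"
    using a g e' by simp
  finally show thesis
    using that g h by blast
qed

lemma minimum_norm_inverse:
  assumes a: "a \<in> S"
  obtains f where "f \<in> S" "a \<cdot> f \<cdot> a = a" "(f \<cdot> a)\<^sup>H = f \<cdot> a"
proof -
  obtain g where g: "g \<in> S" and i: "a\<^sup>H \<cdot> g \<cdot> a\<^sup>H = a\<^sup>H" and h: "(a\<^sup>H \<cdot> g)\<^sup>H = a\<^sup>H \<cdot> g"
    using least_squares_inverse[OF adj_closed[OF a]] .
  have "a \<cdot> g\<^sup>H \<cdot> a = a"
    using arg_cong[OF i, of adj] a g by (simp add: assoc)
  moreover have "(g\<^sup>H \<cdot> a)\<^sup>H = g\<^sup>H \<cdot> a"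
    using h a g by simp
  ultimately show thesis
    using that adj_closed[OF g] by blast
qed

text \<open>
  The Moore-Penrose inverse is \<open>f a g\<close> with \<open>f\<close> a minimum norm inverse and \<open>g\<close> a least squares
  inverse of \<open>a\<close> (Urquhart's formula): its projections are \<open>a g\<close> and \<open>f a\<close>, both self-adjoint.
\<close>

lemma mp_exists:
  assumes a: "a \<in> S"
  obtains x where "mp a x"
proof -
  obtain g where g: "g \<in> S" "a \<cdot> g \<cdot> a = a" "(a \<cdot> g)\<^sup>H = a \<cdot> g"
    using least_squares_inverse[OF a] .
  obtain f where f: "f \<in> S" "a \<cdot> f \<cdot> a = a" "(f \<cdot> a)\<^sup>H = f \<cdot> a"
    using minimum_norm_inverse[OF a] .
  let ?x = "f \<cdot> a \<cdot> g"
  have ax: "a \<cdot> ?x = a \<cdot> g"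
    using a g(1) f(1) by (simp add: assoc[symmetric] f(2))
  have xa: "?x \<cdot> a = f \<cdot> a"
  proof -
    have "?x \<cdot> a = f \<cdot> (a \<cdot> g \<cdot> a)"
      using a g(1) f(1) by (simp add: assoc)
    then show ?thesis
      by (simp only: g(2))
  qed
  have xax: "?x \<cdot> a \<cdot> ?x = ?x"
  proof -
    have "?x \<cdot> a \<cdot> ?x = f \<cdot> (a \<cdot> ?x)"
      using a g(1) f(1) unfolding xa by (simp add: assoc)
    also have "\<dots> = f \<cdot> (a \<cdot> g)"
      by (simp only: ax)
    also have "\<dots> = ?x"
      using a g(1) f(1) by (simp add: assoc)
    finally show ?thesis .
  qed
  have "mp a ?x"
    unfolding mp_def xax unfolding ax xa
    using a g f by (simp del: adj_mult)
  then show thesis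
    using that by blast
qed

lemma mp_closed: "mp a x \<Longrightarrow> x \<in> S"
  by (simp add: mp_def)

lemma mp_absorb:
  assumes a: "a \<in> S" and x: "mp a x"
  shows "a \<cdot> x \<cdot> a = a" "x \<cdot> a \<cdot> x = x"
    and "x\<^sup>H \<cdot> a\<^sup>H = a \<cdot> x" "a\<^sup>H \<cdot> x\<^sup>H = x \<cdot> a"
    and "x \<cdot> a \<cdot> a\<^sup>H = a\<^sup>H" "a\<^sup>H \<cdot> a \<cdot> x = a\<^sup>H"
    and "a \<cdot> a\<^sup>H \<cdot> x\<^sup>H = a" "x\<^sup>H \<cdot> a\<^sup>H \<cdot> a = a"
proof -
  note S = a mp_closed[OF x]
  show 1: "a \<cdot> x \<cdot> a = a" and "x \<cdot> a \<cdot> x = x"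
    using x by (simp_all add: mp_def)
  show 3: "x\<^sup>H \<cdot> a\<^sup>H = a \<cdot> x" and 4: "a\<^sup>H \<cdot> x\<^sup>H = x \<cdot> a"
    using x S by (simp_all add: mp_def)
  show "x\<^sup>H \<cdot> a\<^sup>H \<cdot> a = a"
    using 1 3 by simp
  then have "(x\<^sup>H \<cdot> a\<^sup>H \<cdot> a)\<^sup>H = a\<^sup>H"
    by (rule arg_cong)
  then show "a\<^sup>H \<cdot> a \<cdot> x = a\<^sup>H"
    using S by (simp add: assoc)
  show 7: "a \<cdot> a\<^sup>H \<cdot> x\<^sup>H = a"
    using 1 4 S by (simp add: assoc)
  then have "(a \<cdot> a\<^sup>H \<cdot> x\<^sup>H)\<^sup>H = a\<^sup>H"
    by (rule arg_cong)
  then show "x \<cdot> a \<cdot> a\<^sup>H = a\<^sup>H"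
    using S by (simp add: assoc)
qed

lemma mp_adj:
  assumes a: "a \<in> S" and x: "mp a x"
  shows "mp (a\<^sup>H) (x\<^sup>H)"
proof -
  note S = a mp_closed[OF x]
  have "a\<^sup>H \<cdot> x\<^sup>H \<cdot> a\<^sup>H = a\<^sup>H" "x\<^sup>H \<cdot> a\<^sup>H \<cdot> x\<^sup>H = x\<^sup>H"
    using arg_cong[OF mp_absorb(1)[OF a x], of adj] arg_cong[OF mp_absorb(2)[OF a x], of adj] S
    by (simp_all add: assoc)
  moreover have "(a\<^sup>H \<cdot> x\<^sup>H)\<^sup>H = a\<^sup>H \<cdot> x\<^sup>H" "(x\<^sup>H \<cdot> a\<^sup>H)\<^sup>H = x\<^sup>H \<cdot> a\<^sup>H"
    using S mp_absorb(3,4)[OF a x] by simp_all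
  ultimately show ?thesis
    using S by (simp only: mp_def adj_closed)
qed

text \<open>
  Multiplying \<open>(a b)\<^sup>H = y x (a b) (a b)\<^sup>H\<close> on the left by \<open>a b b\<^sup>H b\<close> and using \<open>b\<^sup>H b y = b\<^sup>H\<close> gives
  \<open>u\<^sup>H u = u\<^sup>H v\<close> for \<open>u = b b\<^sup>H a\<^sup>H\<close> and its projection \<open>v = x a u\<close>. Definiteness then forces
  \<open>u = v\<close>.
\<close>

lemma reverse_order_invariant:
  assumes a: "a \<in> S" and b: "b \<in> S" and x: "mp a x" and y: "mp b y"
    and match: "rows b = rows (a\<^sup>H)" and yx: "mp (a \<cdot> b) (y \<cdot> x)"
  shows "x \<cdot> a \<cdot> b \<cdot> b\<^sup>H \<cdot> a\<^sup>H = b \<cdot> b\<^sup>H \<cdot> a\<^sup>H"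
proof -
  note S = a b mp_closed[OF x] mp_closed[OF y]
  define u where "u = b \<cdot> b\<^sup>H \<cdot> a\<^sup>H"
  define v where "v = x \<cdot> a \<cdot> u"
  have uS: "u \<in> S" and vS: "v \<in> S"
    using S by (simp_all add: u_def v_def)
  have "rows x = rows (x \<cdot> a)"
    using S by simp
  also have "\<dots> = rows (a\<^sup>H)"
    using S by (simp flip: mp_absorb(4)[OF a x])
  finally have "rows u = rows v"
    using S uS match by (simp add: u_def v_def)
  moreover have uv: "u\<^sup>H \<cdot> u = u\<^sup>H \<cdot> v"
  proof -
    have "u\<^sup>H \<cdot> u = a \<cdot> b \<cdot> b\<^sup>H \<cdot> b \<cdot> (a \<cdot> b)\<^sup>H"
      using S by (simp add: u_def assoc)
    also have "\<dots> = a \<cdot> b \<cdot> b\<^sup>H \<cdot> b \<cdot> (y \<cdot> x \<cdot> (a \<cdot> b) \<cdot> (a \<cdot> b)\<^sup>H)"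
      using S mp_absorb(5)[OF _ yx] by simp
    also have "\<dots> = a \<cdot> b \<cdot> (b\<^sup>H \<cdot> b \<cdot> y) \<cdot> (x \<cdot> a \<cdot> b \<cdot> b\<^sup>H \<cdot> a\<^sup>H)"
      using S by (simp add: assoc)
    also have "\<dots> = a \<cdot> b \<cdot> b\<^sup>H \<cdot> (x \<cdot> a \<cdot> b \<cdot> b\<^sup>H \<cdot> a\<^sup>H)"
      by (simp only: mp_absorb(6)[OF b y])
    also have "\<dots> = u\<^sup>H \<cdot> v"
      using S by (simp add: u_def v_def assoc)
    finally show ?thesis .
  qed
  moreover have "v\<^sup>H \<cdot> v = u\<^sup>H \<cdot> v"
  proof -
    have "v\<^sup>H \<cdot> v = u\<^sup>H \<cdot> (a\<^sup>H \<cdot> x\<^sup>H) \<cdot> (x \<cdot> a \<cdot> u)"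
      using S uS by (simp add: v_def assoc)
    also have "\<dots> = u\<^sup>H \<cdot> (x \<cdot> a \<cdot> x) \<cdot> a \<cdot> u"
      unfolding mp_absorb(4)[OF a x] using S uS by (simp add: assoc)
    also have "\<dots> = u\<^sup>H \<cdot> v"
      unfolding mp_absorb(2)[OF a x] using S uS by (simp add: v_def assoc)
    finally show ?thesis .
  qed
  ultimately have "u = v"
    using proper uS vS by blast
  then show ?thesis
    using S by (simp add: u_def v_def assoc)
qed

text \<open>
  With \<open>M = b b\<^sup>H\<close> and \<open>P = x a = a\<^sup>H x\<^sup>H\<close>, multiplying the assumption on the right by
  \<open>x\<^sup>H\<close> gives \<open>P M P = M P\<close>. The
  left-hand side is self-adjoint, hence so is \<open>M P\<close>, which means that \<open>P\<close> and \<open>M\<close> commute.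
\<close>

lemma commute_of_invariant:
  assumes a: "a \<in> S" and b: "b \<in> S" and x: "mp a x"
    and inv: "x \<cdot> a \<cdot> b \<cdot> b\<^sup>H \<cdot> a\<^sup>H = b \<cdot> b\<^sup>H \<cdot> a\<^sup>H"
  shows "x \<cdot> a \<cdot> (b \<cdot> b\<^sup>H) = b \<cdot> b\<^sup>H \<cdot> (x \<cdot> a)"
proof -
  note S = a b mp_closed[OF x]
  let ?m = "b \<cdot> b\<^sup>H" and ?p = "x \<cdot> a"
  have ph: "?p\<^sup>H = ?p"
    using x by (simp only: mp_def)
  have pmp: "?p \<cdot> ?m \<cdot> ?p = ?m \<cdot> ?p"
  proof -
    have "?p \<cdot> ?m \<cdot> ?p = (x \<cdot> a \<cdot> b \<cdot> b\<^sup>H \<cdot> a\<^sup>H) \<cdot> x\<^sup>H"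
      using S by (simp add: assoc flip: mp_absorb(4)[OF a x])
    also have "\<dots> = ?m \<cdot> ?p"
      unfolding inv using S by (simp add: assoc flip: mp_absorb(4)[OF a x])
    finally show ?thesis .
  qed
  have "?p \<cdot> ?m = ?p\<^sup>H \<cdot> ?m\<^sup>H"
    unfolding ph using S by simp
  also have "\<dots> = (?m \<cdot> ?p)\<^sup>H"
    using S by (simp del: adj_mult add: adj_mult[symmetric])
  also have "\<dots> = (?p \<cdot> ?m \<cdot> ?p)\<^sup>H"
    by (simp only: pmp)
  also have "\<dots> = ?p\<^sup>H \<cdot> ?m\<^sup>H \<cdot> ?p\<^sup>H"
    using S by (simp add: assoc)
  also have "\<dots> = ?p \<cdot> ?m \<cdot> ?p"
    unfolding ph using S by simp
  also have "\<dots> = ?m \<cdot> ?p"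
    by (rule pmp)
  finally show ?thesis .
qed

text \<open>
  The projection \<open>q = b y\<close> equals \<open>(b b\<^sup>H) (y\<^sup>H y)\<close>. So \<open>p q = (b b\<^sup>H) p (y\<^sup>H y)\<close> is fixed by \<open>q\<close> from the
  left; thus \<open>p q = q p q\<close> is self-adjoint.
\<close>

lemma projection_commute:
  assumes b: "b \<in> S" and y: "mp b y" and p: "p \<in> S" and ph: "p\<^sup>H = p"
    and pm: "p \<cdot> (b \<cdot> b\<^sup>H) = b \<cdot> b\<^sup>H \<cdot> p"
  shows "p \<cdot> (b \<cdot> y) = b \<cdot> y \<cdot> p"
proof -
  note S = b p mp_closed[OF y]
  let ?q = "b \<cdot> y"
  have qh: "?q\<^sup>H = ?q"
    using y by (simp only: mp_def)
  have pq: "p \<cdot> ?q = b \<cdot> b\<^sup>H \<cdot> p \<cdot> (y\<^sup>H \<cdot> y)"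
  proof -
    have "p \<cdot> ?q = p \<cdot> (b \<cdot> b\<^sup>H \<cdot> y\<^sup>H \<cdot> y)"
      by (simp only: mp_absorb(7)[OF b y])
    also have "\<dots> = p \<cdot> (b \<cdot> b\<^sup>H) \<cdot> (y\<^sup>H \<cdot> y)"
      using S by (simp add: assoc)
    finally show ?thesis
      unfolding pm .
  qed
  have qpq: "?q \<cdot> p \<cdot> ?q = p \<cdot> ?q"
  proof -
    have "?q \<cdot> p \<cdot> ?q = ?q \<cdot> (p \<cdot> ?q)"
      using S by (simp add: assoc)
    also have "\<dots> = b \<cdot> y \<cdot> b \<cdot> (b\<^sup>H \<cdot> p \<cdot> (y\<^sup>H \<cdot> y))"
      unfolding pq using S by (simp add: assoc)
    also have "\<dots> = p \<cdot> ?q"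
      unfolding mp_absorb(1)[OF b y] pq using S by (simp add: assoc)
    finally show ?thesis .
  qed
  have "p \<cdot> ?q = ?q\<^sup>H \<cdot> p\<^sup>H \<cdot> ?q\<^sup>H"
    by (simp only: qpq qh ph)
  also have "\<dots> = (?q \<cdot> p \<cdot> ?q)\<^sup>H"
    using S by (simp add: assoc)
  also have "\<dots> = ?q\<^sup>H \<cdot> p\<^sup>H"
    unfolding qpq using S by simp
  also have "\<dots> = ?q \<cdot> p"
    by (simp only: qh ph)
  finally show ?thesis .
qed

lemma reverse_order_of_commute:
  assumes a: "a \<in> S" and b: "b \<in> S" and x: "mp a x" and y: "mp b y"
    and pm: "x \<cdot> a \<cdot> (b \<cdot> b\<^sup>H) = b \<cdot> b\<^sup>H \<cdot> (x \<cdot> a)"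
    and kq: "b \<cdot> y \<cdot> (a\<^sup>H \<cdot> a) = a\<^sup>H \<cdot> a \<cdot> (b \<cdot> y)"
  shows "mp (a \<cdot> b) (y \<cdot> x)"
proof -
  note S = a b mp_closed[OF x] mp_closed[OF y]
  have ph: "(x \<cdot> a)\<^sup>H = x \<cdot> a" and qh: "(b \<cdot> y)\<^sup>H = b \<cdot> y"
    using x y by (simp_all only: mp_def)
  have pq: "x \<cdot> a \<cdot> (b \<cdot> y) = b \<cdot> y \<cdot> (x \<cdot> a)"
    using projection_commute[OF b y _ ph pm] S by simp
  have "a \<cdot> b \<cdot> (y \<cdot> x) \<cdot> (a \<cdot> b) = a \<cdot> (b \<cdot> y \<cdot> (x \<cdot> a)) \<cdot> b"
    using S by (simp add: assoc)
  also have "\<dots> = a \<cdot> x \<cdot> a \<cdot> (b \<cdot> y \<cdot> b)"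
    unfolding pq[symmetric] using S by (simp add: assoc)
  finally have 1: "a \<cdot> b \<cdot> (y \<cdot> x) \<cdot> (a \<cdot> b) = a \<cdot> b"
    unfolding mp_absorb(1)[OF a x] mp_absorb(1)[OF b y] .
  have "y \<cdot> x \<cdot> (a \<cdot> b) \<cdot> (y \<cdot> x) = y \<cdot> (x \<cdot> a \<cdot> (b \<cdot> y)) \<cdot> x"
    using S by (simp add: assoc)
  also have "\<dots> = y \<cdot> b \<cdot> y \<cdot> (x \<cdot> a \<cdot> x)"
    unfolding pq using S by (simp add: assoc)
  finally have 2: "y \<cdot> x \<cdot> (a \<cdot> b) \<cdot> (y \<cdot> x) = y \<cdot> x"
    unfolding mp_absorb(2)[OF a x] mp_absorb(2)[OF b y] .
  have "a \<cdot> b \<cdot> (y \<cdot> x) = x\<^sup>H \<cdot> a\<^sup>H \<cdot> a \<cdot> b \<cdot> (y \<cdot> x)"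
    unfolding mp_absorb(8)[OF a x] ..
  also have "\<dots> = x\<^sup>H \<cdot> (a\<^sup>H \<cdot> a \<cdot> (b \<cdot> y)) \<cdot> x"
    using S by (simp add: assoc)
  also have "\<dots> = x\<^sup>H \<cdot> (b \<cdot> y) \<cdot> (a\<^sup>H \<cdot> a \<cdot> x)"
    unfolding kq[symmetric] using S by (simp add: assoc)
  also have "\<dots> = x\<^sup>H \<cdot> (b \<cdot> y)\<^sup>H \<cdot> a\<^sup>H"
    unfolding mp_absorb(6)[OF a x] qh ..
  also have "\<dots> = (a \<cdot> b \<cdot> (y \<cdot> x))\<^sup>H"
    using S by (simp add: assoc)
  finally have 3: "(a \<cdot> b \<cdot> (y \<cdot> x))\<^sup>H = a \<cdot> b \<cdot> (y \<cdot> x)" ..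
  have "y \<cdot> x \<cdot> (a \<cdot> b) = y \<cdot> x \<cdot> (a \<cdot> (b \<cdot> b\<^sup>H \<cdot> y\<^sup>H))"
    unfolding mp_absorb(7)[OF b y] ..
  also have "\<dots> = y \<cdot> (x \<cdot> a \<cdot> (b \<cdot> b\<^sup>H)) \<cdot> y\<^sup>H"
    using S by (simp add: assoc)
  also have "\<dots> = y \<cdot> b \<cdot> b\<^sup>H \<cdot> (x \<cdot> a) \<cdot> y\<^sup>H"
    unfolding pm using S by (simp add: assoc)
  also have "\<dots> = b\<^sup>H \<cdot> (x \<cdot> a)\<^sup>H \<cdot> y\<^sup>H"
    unfolding mp_absorb(5)[OF b y] ph ..
  also have "\<dots> = (y \<cdot> x \<cdot> (a \<cdot> b))\<^sup>H"
    using S by (simp add: assoc)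
  finally have 4: "(y \<cdot> x \<cdot> (a \<cdot> b))\<^sup>H = y \<cdot> x \<cdot> (a \<cdot> b)" ..
  show ?thesis
    using 1 2 3 4 S unfolding mp_def by simp
qed

text \<open>
  Greville's characterisation of the reverse order law. Both directions treat the second condition
  as the first one for \<open>b\<^sup>H\<close> and \<open>a\<^sup>H\<close>, whose Moore-Penrose inverses are \<open>y\<^sup>H\<close> and \<open>x\<^sup>H\<close>.
\<close>

theorem reverse_order_iff_invariant:
  assumes a: "a \<in> S" and b: "b \<in> S" and x: "mp a x" and y: "mp b y"
    and match: "rows b = rows (a\<^sup>H)"
  shows "mp (a \<cdot> b) (y \<cdot> x) \<longleftrightarrow>
    x \<cdot> a \<cdot> b \<cdot> b\<^sup>H \<cdot> a\<^sup>H = b \<cdot> b\<^sup>H \<cdot> a\<^sup>H \<and> b \<cdot> y \<cdot> a\<^sup>H \<cdot> a \<cdot> b = a\<^sup>H \<cdot> a \<cdot> b"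
    (is "?L \<longleftrightarrow> ?R")
proof -
  note S = a b mp_closed[OF x] mp_closed[OF y]
  have ax: "mp (a\<^sup>H) (x\<^sup>H)" and yb: "mp (b\<^sup>H) (y\<^sup>H)"
    using mp_adj a b x y by blast+
  have bh: "y\<^sup>H \<cdot> b\<^sup>H = b \<cdot> y"
    using mp_absorb(3)[OF b y] .
  show ?thesis
  proof
    assume yx: ?L
    have "mp (b\<^sup>H \<cdot> a\<^sup>H) (x\<^sup>H \<cdot> y\<^sup>H)"
      using mp_adj[OF _ yx] S by simp
    then have "y\<^sup>H \<cdot> b\<^sup>H \<cdot> a\<^sup>H \<cdot> a\<^sup>H\<^sup>H \<cdot> b\<^sup>H\<^sup>H = a\<^sup>H \<cdot> a\<^sup>H\<^sup>H \<cdot> b\<^sup>H\<^sup>H"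
      by (intro reverse_order_invariant) (use S ax yb match in simp_all)
    then have "b \<cdot> y \<cdot> a\<^sup>H \<cdot> a \<cdot> b = a\<^sup>H \<cdot> a \<cdot> b"
      using S by (simp add: bh)
    then show ?R
      using reverse_order_invariant[OF a b x y match yx] by simp
  next
    assume ?R
    then have pm: "x \<cdot> a \<cdot> (b \<cdot> b\<^sup>H) = b \<cdot> b\<^sup>H \<cdot> (x \<cdot> a)"
      and "b \<cdot> y \<cdot> a\<^sup>H \<cdot> a \<cdot> b = a\<^sup>H \<cdot> a \<cdot> b"
      using commute_of_invariant a b x by simp_all
    then have "b \<cdot> y \<cdot> (a\<^sup>H \<cdot> a) = a\<^sup>H \<cdot> a \<cdot> (b \<cdot> y)"
      using commute_of_invariant[of "b\<^sup>H" "a\<^sup>H" "y\<^sup>H"] S yb by (simp add: bh)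
    then show ?L
      using reverse_order_of_commute a b x y pm by blast
  qed
qed

text \<open>
  The single equation merges Greville's two conditions: the idempotents \<open>x a\<close> on the left and \<open>b y\<close>
  on the right can be read off separately. The factor \<open>a\<close> is cancelled by \<open>a\<^sup>H a x = a\<^sup>H\<close>, and the
  factor \<open>b\<close> by \<open>y b b\<^sup>H = b\<^sup>H\<close>.
\<close>

theorem reverse_order_iff:
  assumes a: "a \<in> S" and b: "b \<in> S" and x: "mp a x" and y: "mp b y"
    and match: "rows b = rows (a\<^sup>H)"
  shows "mp (a \<cdot> b) (y \<cdot> x) \<longleftrightarrow>
    x \<cdot> a \<cdot> b \<cdot> b\<^sup>H \<cdot> a\<^sup>H \<cdot> a \<cdot> b \<cdot> y = b \<cdot> b\<^sup>H \<cdot> a\<^sup>H \<cdot> a" (is "_ \<longleftrightarrow> ?E")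
proof -
  note S = a b mp_closed[OF x] mp_closed[OF y]
  let ?mk = "b \<cdot> b\<^sup>H \<cdot> a\<^sup>H \<cdot> a"
  have "?E \<longleftrightarrow> x \<cdot> a \<cdot> ?mk = ?mk \<and> ?mk \<cdot> (b \<cdot> y) = ?mk"
  proof
    assume e: ?E
    have "x \<cdot> a \<cdot> ?mk = x \<cdot> a \<cdot> x \<cdot> (a \<cdot> b \<cdot> b\<^sup>H \<cdot> a\<^sup>H \<cdot> a \<cdot> b \<cdot> y)"
      unfolding e[symmetric] using S by (simp add: assoc)
    also have "\<dots> = ?mk"
      unfolding mp_absorb(2)[OF a x] e[symmetric] using S by (simp add: assoc)
    finally have l: "x \<cdot> a \<cdot> ?mk = ?mk" .
    have "?mk \<cdot> (b \<cdot> y) = x \<cdot> a \<cdot> b \<cdot> b\<^sup>H \<cdot> a\<^sup>H \<cdot> a \<cdot> b \<cdot> (y \<cdot> b \<cdot> y)"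
      unfolding e[symmetric] using S by (simp add: assoc)
    then have r: "?mk \<cdot> (b \<cdot> y) = ?mk"
      unfolding mp_absorb(2)[OF b y] e .
    show "x \<cdot> a \<cdot> ?mk = ?mk \<and> ?mk \<cdot> (b \<cdot> y) = ?mk"
      using l r ..
  next
    assume lr: "x \<cdot> a \<cdot> ?mk = ?mk \<and> ?mk \<cdot> (b \<cdot> y) = ?mk"
    have "x \<cdot> a \<cdot> b \<cdot> b\<^sup>H \<cdot> a\<^sup>H \<cdot> a \<cdot> b \<cdot> y = x \<cdot> a \<cdot> ?mk \<cdot> (b \<cdot> y)"
      using S by (simp add: assoc)
    then show ?E
      using lr by simp
  qed
  also have "x \<cdot> a \<cdot> ?mk = ?mk \<longleftrightarrow> x \<cdot> a \<cdot> b \<cdot> b\<^sup>H \<cdot> a\<^sup>H = b \<cdot> b\<^sup>H \<cdot> a\<^sup>H"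
  proof
    assume e: "x \<cdot> a \<cdot> ?mk = ?mk"
    have "x \<cdot> a \<cdot> b \<cdot> b\<^sup>H \<cdot> (a\<^sup>H \<cdot> a \<cdot> x) = x \<cdot> a \<cdot> ?mk \<cdot> x"
      using S by (simp add: assoc)
    also have "\<dots> = b \<cdot> b\<^sup>H \<cdot> (a\<^sup>H \<cdot> a \<cdot> x)"
      unfolding e using S by (simp add: assoc)
    finally show "x \<cdot> a \<cdot> b \<cdot> b\<^sup>H \<cdot> a\<^sup>H = b \<cdot> b\<^sup>H \<cdot> a\<^sup>H"
      unfolding mp_absorb(6)[OF a x] .
  next
    assume e: "x \<cdot> a \<cdot> b \<cdot> b\<^sup>H \<cdot> a\<^sup>H = b \<cdot> b\<^sup>H \<cdot> a\<^sup>H"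
    have "x \<cdot> a \<cdot> ?mk = x \<cdot> a \<cdot> b \<cdot> b\<^sup>H \<cdot> a\<^sup>H \<cdot> a"
      using S by (simp add: assoc)
    then show "x \<cdot> a \<cdot> ?mk = ?mk"
      unfolding e .
  qed
  also have "?mk \<cdot> (b \<cdot> y) = ?mk \<longleftrightarrow> b \<cdot> y \<cdot> a\<^sup>H \<cdot> a \<cdot> b = a\<^sup>H \<cdot> a \<cdot> b"
  proof -
    have qh: "y\<^sup>H \<cdot> b\<^sup>H = b \<cdot> y"
      using mp_absorb(3)[OF b y] .
    have "?mk \<cdot> (b \<cdot> y) = ?mk \<longleftrightarrow> b\<^sup>H \<cdot> a\<^sup>H \<cdot> a \<cdot> (b \<cdot> y) = b\<^sup>H \<cdot> a\<^sup>H \<cdot> a"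
    proof
      assume e: "?mk \<cdot> (b \<cdot> y) = ?mk"
      have "(y \<cdot> b \<cdot> b\<^sup>H) \<cdot> a\<^sup>H \<cdot> a \<cdot> (b \<cdot> y) = y \<cdot> (?mk \<cdot> (b \<cdot> y))"
        using S by (simp add: assoc)
      also have "\<dots> = (y \<cdot> b \<cdot> b\<^sup>H) \<cdot> a\<^sup>H \<cdot> a"
        unfolding e using S by (simp add: assoc)
      finally show "b\<^sup>H \<cdot> a\<^sup>H \<cdot> a \<cdot> (b \<cdot> y) = b\<^sup>H \<cdot> a\<^sup>H \<cdot> a"
        unfolding mp_absorb(5)[OF b y] .
    next
      assume e: "b\<^sup>H \<cdot> a\<^sup>H \<cdot> a \<cdot> (b \<cdot> y) = b\<^sup>H \<cdot> a\<^sup>H \<cdot> a"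
      have "?mk \<cdot> (b \<cdot> y) = b \<cdot> (b\<^sup>H \<cdot> a\<^sup>H \<cdot> a \<cdot> (b \<cdot> y))"
        using S by (simp add: assoc)
      then show "?mk \<cdot> (b \<cdot> y) = ?mk"
        unfolding e using S by (simp add: assoc)
    qed
    also have "\<dots> \<longleftrightarrow> (b\<^sup>H \<cdot> a\<^sup>H \<cdot> a \<cdot> (b \<cdot> y))\<^sup>H = (b\<^sup>H \<cdot> a\<^sup>H \<cdot> a)\<^sup>H"
      using S by (metis adj_adj adj_closed mult_closed)
    also have "(b\<^sup>H \<cdot> a\<^sup>H \<cdot> a \<cdot> (b \<cdot> y))\<^sup>H = y\<^sup>H \<cdot> b\<^sup>H \<cdot> a\<^sup>H \<cdot> a \<cdot> b"
      using S by (simp add: assoc)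
    also have "y\<^sup>H \<cdot> b\<^sup>H \<cdot> a\<^sup>H \<cdot> a \<cdot> b = b \<cdot> y \<cdot> a\<^sup>H \<cdot> a \<cdot> b"
      by (simp only: qh)
    also have "(b\<^sup>H \<cdot> a\<^sup>H \<cdot> a)\<^sup>H = a\<^sup>H \<cdot> a \<cdot> b"
      using S by (simp add: assoc)
    finally show ?thesis .
  qed
  finally show ?thesis
    using reverse_order_iff_invariant[OF a b x y match] by simp
qed

end

section \<open>Least squares\<close>

text \<open>
  Gram-Schmidt, by induction on the set of columns. By induction the new column \<open>c\<close> and the
  right-hand side \<open>b\<close> have residuals \<open>r\<close> and \<open>s\<close> orthogonal to the old columns. Subtracting from \<open>s\<close>
  its component along \<open>r\<close> yields a residual orthogonal to \<open>r\<close> as well, hence to the column \<open>c\<close>,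
  which differs from \<open>r\<close> by a combination of old columns.
\<close>

lemma normal_equations_solvable:
  fixes a :: "'r \<Rightarrow> 'c \<Rightarrow> complex" and b :: "'r \<Rightarrow> complex"
  assumes "finite L" and K: "finite K"
  shows "\<exists>x. \<forall>l\<in>L. (\<Sum>k\<in>K. cnj (a k l) * (b k - (\<Sum>j\<in>L. a k j * x j))) = 0"
  using assms(1)
proof (induction L arbitrary: b rule: finite_induct)
  case empty
  then show ?case by simp
next
  case (insert c L)
  obtain x0 where x0: "\<forall>l\<in>L. (\<Sum>k\<in>K. cnj (a k l) * (a k c - (\<Sum>j\<in>L. a k j * x0 j))) = 0"
    using insert.IH[of "\<lambda>k. a k c"] by blast
  obtain x1 where x1: "\<forall>l\<in>L. (\<Sum>k\<in>K. cnj (a k l) * (b k - (\<Sum>j\<in>L. a k j * x1 j))) = 0"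
    using insert.IH by blast
  define r where "r k = a k c - (\<Sum>j\<in>L. a k j * x0 j)" for k
  define s where "s k = b k - (\<Sum>j\<in>L. a k j * x1 j)" for k
  \<comment> \<open>If \<open>r\<close> vanishes, the quotient is 0 and \<open>s\<close> needs no correction.\<close>
  define t where "t = (\<Sum>k\<in>K. cnj (r k) * s k) / (\<Sum>k\<in>K. cnj (r k) * r k)"
  define w where "w k = s k - t * r k" for k
  define x where "x j = (if j = c then t else x1 j - t * x0 j)" for j
  have old: "(\<Sum>k\<in>K. cnj (a k l) * w k) = 0" if "l \<in> L" for l
  proof -
    have "(\<Sum>k\<in>K. cnj (a k l) * w k)
        = (\<Sum>k\<in>K. cnj (a k l) * s k) - t * (\<Sum>k\<in>K. cnj (a k l) * r k)"
      by (simp add: w_def algebra_simps sum_subtractf sum_distrib_left)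
    then show ?thesis
      using x0 x1 that by (simp add: r_def s_def)
  qed
  have "(\<Sum>k\<in>K. cnj (r k) * w k) = (\<Sum>k\<in>K. cnj (r k) * s k) - t * (\<Sum>k\<in>K. cnj (r k) * r k)"
    by (simp add: w_def algebra_simps sum_subtractf sum_distrib_left)
  also have "\<dots> = 0"
  proof (cases "(\<Sum>k\<in>K. cnj (r k) * r k) = 0")
    case True
    have "(\<Sum>k\<in>K. cnj (r k) * r k) = complex_of_real (\<Sum>k\<in>K. (cmod (r k))\<^sup>2)"
      by (simp add: mult.commute flip: complex_norm_square)
    with True have "(\<Sum>k\<in>K. (cmod (r k))\<^sup>2) = 0"
      by (metis of_real_eq_0_iff)
    then have "\<forall>k\<in>K. r k = 0"
      using K by (simp add: sum_nonneg_eq_0_iff)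
    then show ?thesis by simp
  qed (simp add: t_def)
  finally have rw: "(\<Sum>k\<in>K. cnj (r k) * w k) = 0" .
  have new: "(\<Sum>k\<in>K. cnj (a k c) * w k) = 0"
  proof -
    have "(\<Sum>k\<in>K. cnj (a k c) * w k)
        = (\<Sum>k\<in>K. cnj (r k) * w k + (\<Sum>j\<in>L. cnj (x0 j) * (cnj (a k j) * w k)))"
      by (intro sum.cong refl)
        (simp add: r_def algebra_simps sum_distrib_left)
    also have "\<dots> = (\<Sum>j\<in>L. cnj (x0 j) * (\<Sum>k\<in>K. cnj (a k j) * w k))"
      by (simp add: sum.distrib rw sum_distrib_left sum.swap[of _ L K])
    also have "\<dots> = 0"
      by (simp add: old)
    finally show ?thesis .
  qed
  have w: "b k - (\<Sum>j\<in>insert c L. a k j * x j) = w k" for k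
  proof -
    have "(\<Sum>j\<in>L. a k j * x j) = (\<Sum>j\<in>L. a k j * x1 j - t * (a k j * x0 j))"
      using insert.hyps by (intro sum.cong) (auto simp: x_def algebra_simps)
    then show ?thesis
      using insert.hyps
      by (simp add: w_def s_def r_def x_def sum_subtractf algebra_simps flip: sum_distrib_left)
  qed
  show ?case
    using old new by (intro exI[of _ x]) (auto simp: w)
qed

section \<open>Tensors of even order\<close>

lemma finite_idx [simp]: "finite (idx ds)"
proof (induction ds)
  case Nil
  then show ?case by (simp add: idx_def)
next
  case (Cons d ds)
  have "idx (d # ds) = (\<lambda>(i, is). i # is) ` ({..<d} \<times> idx ds)"
    by (auto simp: idx_def list_all2_Cons2)
  then show ?case
    using Cons by simp
qed

lemma length_idx: "is \<in> idx ds \<Longrightarrow> length is = length ds"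
  by (simp add: idx_def list_all2_lengthD)

lemma append_idx_iff:
  "length is = length ds \<Longrightarrow> is @ js \<in> idx (ds @ es) \<longleftrightarrow> is \<in> idx ds \<and> js \<in> idx es"
  by (simp add: idx_def list_all2_append)

lemma entry_outside: "is \<notin> idx (dims A) \<Longrightarrow> entry A is = 0"
  using Rep_tensor[of A] by (auto simp: dims_def entry_def split: prod.splits)

abbreviation row_dims :: "nat \<Rightarrow> tensor \<Rightarrow> nat list" where
  "row_dims N A \<equiv> take N (dims A)"

abbreviation col_dims :: "nat \<Rightarrow> tensor \<Rightarrow> nat list" where
  "col_dims N A \<equiv> drop N (dims A)"

definition even_tensors :: "nat \<Rightarrow> tensor set" where
  "even_tensors N = {A. length (dims A) = 2 * N}"

context
  fixes N :: nat
begin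

text \<open>
  Multi-indices of a tensor of order \<open>2N\<close> are handled as concatenations of a row index and a column
  index of length \<open>N\<close>.
\<close>

lemma split_idx_iff:
  assumes "A \<in> even_tensors N" "length i = N"
  shows "i @ j \<in> idx (dims A) \<longleftrightarrow> i \<in> idx (row_dims N A) \<and> j \<in> idx (col_dims N A)"
  using append_idx_iff[of i "row_dims N A" j "col_dims N A"] assms
  by (simp add: even_tensors_def)

lemma length_split_idx:
  assumes "A \<in> even_tensors N"
  shows "i \<in> idx (row_dims N A) \<Longrightarrow> length i = N" "j \<in> idx (col_dims N A) \<Longrightarrow> length j = N"
  using assms by (auto dest!: length_idx simp: even_tensors_def)

lemma even_tensor_eqI:
  assumes A: "A \<in> even_tensors N"
    and rows: "row_dims N A = row_dims N B" and cols: "col_dims N A = col_dims N B"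
    and e: "\<And>i j. \<lbrakk>i \<in> idx (row_dims N A); j \<in> idx (col_dims N A)\<rbrakk>
      \<Longrightarrow> entry A (i @ j) = entry B (i @ j)"
  shows "A = B"
proof (rule tensor_eqI)
  show "dims A = dims B"
    using rows cols by (metis append_take_drop_id)
  fix "is" assume "is": "is \<in> idx (dims A)"
  then have "length (take N is) = N"
    using A length_idx[OF "is"] by (simp add: even_tensors_def)
  then have "take N is \<in> idx (row_dims N A) \<and> drop N is \<in> idx (col_dims N A)"
    using split_idx_iff[OF A, of "take N is" "drop N is"] "is" by simp
  then show "entry A is = entry B is"
    using e[of "take N is" "drop N is"] by simp
qed

lemma dims_einstein:
  assumes "A \<in> even_tensors N" "B \<in> even_tensors N"
  shows "row_dims N (A \<star>\<^bsub>N\<^esub> B) = row_dims N A" "col_dims N (A \<star>\<^bsub>N\<^esub> B) = col_dims N B"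
    and "A \<star>\<^bsub>N\<^esub> B \<in> even_tensors N"
  using assms by (auto simp: einstein_def even_tensors_def)

lemma dims_ctranspose:
  assumes "A \<in> even_tensors N"
  shows "row_dims N (ctranspose N A) = col_dims N A" "col_dims N (ctranspose N A) = row_dims N A"
    and "ctranspose N A \<in> even_tensors N"
  using assms by (auto simp: ctranspose_def even_tensors_def)

text \<open>
  The column index \<open>j\<close> is arbitrary here: outside the index range of the product every summand
  contains an entry outside the range of one of the factors.
\<close>

lemma entry_einstein:
  assumes A: "A \<in> even_tensors N" and B: "B \<in> even_tensors N" and i: "length i = N"
  shows "entry (A \<star>\<^bsub>N\<^esub> B) (i @ j)
    = (\<Sum>k\<in>idx (col_dims N A). entry A (i @ k) * entry B (k @ j))"
proof (cases "i \<in> idx (row_dims N A) \<and> j \<in> idx (col_dims N B)")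
  case True
  then have "i @ j \<in> idx (row_dims N A @ col_dims N B)"
    using append_idx_iff[of i "row_dims N A"] A i by (simp add: even_tensors_def)
  then show ?thesis
    using i by (simp add: einstein_def entry_mk_tensor)
next
  case False
  have "entry A (i @ k) * entry B (k @ j) = 0" if "k \<in> idx (col_dims N A)" for k
    using False entry_outside split_idx_iff[OF A i] split_idx_iff[OF B length_split_idx(2)[OF A that]]
    by (metis mult_eq_0_iff)
  then have "(\<Sum>k\<in>idx (col_dims N A). entry A (i @ k) * entry B (k @ j)) = 0"
    by (intro sum.neutral ballI)
  moreover have "entry (A \<star>\<^bsub>N\<^esub> B) (i @ j) = 0"
    using False split_idx_iff[OF dims_einstein(3)[OF A B] i] dims_einstein[OF A B] entry_outside
    by metis
  ultimately show ?thesis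
    by simp
qed

text \<open>
  The summation may equally run over the row indices of the right factor, because a term whose
  index is in range for only one factor is 0. For factors of mismatched dimensions the adjoint of a
  product naturally produces this second form.
\<close>

lemma entry_einstein_right:
  assumes A: "A \<in> even_tensors N" and B: "B \<in> even_tensors N" and i: "length i = N"
  shows "entry (A \<star>\<^bsub>N\<^esub> B) (i @ j)
    = (\<Sum>k\<in>idx (row_dims N B). entry A (i @ k) * entry B (k @ j))"
  unfolding entry_einstein[OF assms]
proof (rule sum.mono_neutral_cong)
  fix k assume "k \<in> idx (row_dims N B) - idx (col_dims N A)"
  then show "entry A (i @ k) * entry B (k @ j) = 0"
    using split_idx_iff[OF A i] entry_outside by auto
next
  fix k assume k: "k \<in> idx (col_dims N A) - idx (row_dims N B)"
  then have "length k = N"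
    using length_split_idx(2)[OF A] by blast
  then show "entry A (i @ k) * entry B (k @ j) = 0"
    using split_idx_iff[OF B] entry_outside k by auto
qed auto

lemma entry_ctranspose:
  assumes A: "A \<in> even_tensors N" and i: "length i = N" and j: "length j = N"
  shows "entry (ctranspose N A) (j @ i) = cnj (entry A (i @ j))"
proof (cases "i @ j \<in> idx (dims A)")
  case True
  then have "j @ i \<in> idx (col_dims N A @ row_dims N A)"
    using append_idx_iff[of j "col_dims N A"] A j split_idx_iff[OF A i]
    by (simp add: even_tensors_def)
  then show ?thesis
    using j by (simp add: ctranspose_def entry_mk_tensor)
next
  case False
  then have "entry (ctranspose N A) (j @ i) = 0"
    using split_idx_iff[OF dims_ctranspose(3)[OF A] j] dims_ctranspose[OF A] split_idx_iff[OF A i]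
      entry_outside by metis
  then show ?thesis
    using False by (simp add: entry_outside)
qed

lemma einstein_assoc:
  assumes A: "A \<in> even_tensors N" and B: "B \<in> even_tensors N" and C: "C \<in> even_tensors N"
  shows "A \<star>\<^bsub>N\<^esub> B \<star>\<^bsub>N\<^esub> C = A \<star>\<^bsub>N\<^esub> (B \<star>\<^bsub>N\<^esub> C)"
proof (rule even_tensor_eqI)
  note [simp] = dims_einstein A B C
  fix i j assume i: "i \<in> idx (row_dims N (A \<star>\<^bsub>N\<^esub> B \<star>\<^bsub>N\<^esub> C))"
  then have li: "length i = N"
    by (simp add: length_split_idx(1)[OF A])
  have "entry (A \<star>\<^bsub>N\<^esub> B \<star>\<^bsub>N\<^esub> C) (i @ j)
      = (\<Sum>k\<in>idx (col_dims N B). (\<Sum>l\<in>idx (col_dims N A).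
          entry A (i @ l) * entry B (l @ k)) * entry C (k @ j))"
    using li by (simp add: entry_einstein)
  also have "\<dots> = (\<Sum>l\<in>idx (col_dims N A). \<Sum>k\<in>idx (col_dims N B).
          entry A (i @ l) * (entry B (l @ k) * entry C (k @ j)))"
    by (simp add: sum_distrib_right mult.assoc sum.swap[of _ "idx (col_dims N A)"])
  also have "\<dots> = (\<Sum>l\<in>idx (col_dims N A). entry A (i @ l) * entry (B \<star>\<^bsub>N\<^esub> C) (l @ j))"
    by (intro sum.cong refl) (simp add: entry_einstein length_split_idx(2)[OF A] sum_distrib_left)
  also have "\<dots> = entry (A \<star>\<^bsub>N\<^esub> (B \<star>\<^bsub>N\<^esub> C)) (i @ j)"
    using li by (simp add: entry_einstein)
  finally show "entry (A \<star>\<^bsub>N\<^esub> B \<star>\<^bsub>N\<^esub> C) (i @ j) = entry (A \<star>\<^bsub>N\<^esub> (B \<star>\<^bsub>N\<^esub> C)) (i @ j)" .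
qed (simp_all add: dims_einstein A B C)

lemma ctranspose_ctranspose:
  assumes A: "A \<in> even_tensors N"
  shows "ctranspose N (ctranspose N A) = A"
proof (rule even_tensor_eqI)
  note [simp] = dims_ctranspose A
  fix i j
  assume "i \<in> idx (row_dims N (ctranspose N (ctranspose N A)))"
    and "j \<in> idx (col_dims N (ctranspose N (ctranspose N A)))"
  then have "i \<in> idx (row_dims N A)" "j \<in> idx (col_dims N A)"
    by simp_all
  then have "length i = N" "length j = N"
    using length_split_idx[OF A] by blast+
  then show "entry (ctranspose N (ctranspose N A)) (i @ j) = entry A (i @ j)"
    by (simp add: entry_ctranspose)
qed (simp_all add: dims_ctranspose A)

lemma ctranspose_einstein:
  assumes A: "A \<in> even_tensors N" and B: "B \<in> even_tensors N"
  shows "ctranspose N (A \<star>\<^bsub>N\<^esub> B) = ctranspose N B \<star>\<^bsub>N\<^esub> ctranspose N A"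
proof (rule even_tensor_eqI)
  note [simp] = dims_einstein dims_ctranspose A B
  fix j i
  assume "j \<in> idx (row_dims N (ctranspose N (A \<star>\<^bsub>N\<^esub> B)))"
    and "i \<in> idx (col_dims N (ctranspose N (A \<star>\<^bsub>N\<^esub> B)))"
  then have "j \<in> idx (col_dims N B)" "i \<in> idx (row_dims N A)"
    by simp_all
  then have j: "length j = N" and i: "length i = N"
    using length_split_idx A B by blast+
  have "entry (ctranspose N (A \<star>\<^bsub>N\<^esub> B)) (j @ i)
      = (\<Sum>k\<in>idx (col_dims N A). cnj (entry A (i @ k)) * cnj (entry B (k @ j)))"
    using i j by (simp add: entry_ctranspose entry_einstein)
  also have "\<dots> = (\<Sum>k\<in>idx (col_dims N A).
      entry (ctranspose N B) (j @ k) * entry (ctranspose N A) (k @ i))"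
    using i j by (intro sum.cong refl) (simp add: entry_ctranspose length_split_idx(2)[OF A])
  also have "\<dots> = entry (ctranspose N B \<star>\<^bsub>N\<^esub> ctranspose N A) (j @ i)"
    using j by (simp add: entry_einstein_right)
  finally show "entry (ctranspose N (A \<star>\<^bsub>N\<^esub> B)) (j @ i)
      = entry (ctranspose N B \<star>\<^bsub>N\<^esub> ctranspose N A) (j @ i)" .
qed (simp_all add: dims_einstein dims_ctranspose A B)

lemma entry_gram:
  assumes A: "A \<in> even_tensors N" and B: "B \<in> even_tensors N"
    and rows: "row_dims N A = row_dims N B" and j: "length j = N"
  shows "entry (ctranspose N A \<star>\<^bsub>N\<^esub> B) (j @ l)
    = (\<Sum>k\<in>idx (row_dims N A). cnj (entry A (k @ j)) * entry B (k @ l))"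
  using A B j by (simp add: entry_einstein dims_ctranspose entry_ctranspose length_split_idx(1)[OF A])

text \<open>
  The diagonal entries of the Gram tensor of \<open>A - B\<close> are the sums of the squared moduli of its
  columns, and they expand into the entries of the four products.
\<close>

lemma einstein_proper:
  assumes A: "A \<in> even_tensors N" and B: "B \<in> even_tensors N"
    and rows: "row_dims N A = row_dims N B"
    and AA: "ctranspose N A \<star>\<^bsub>N\<^esub> A = ctranspose N A \<star>\<^bsub>N\<^esub> B"
    and BB: "ctranspose N B \<star>\<^bsub>N\<^esub> B = ctranspose N A \<star>\<^bsub>N\<^esub> B"
  shows "A = B"
proof (rule even_tensor_eqI[OF A rows])
  show "col_dims N A = col_dims N B"
    using arg_cong[OF AA, of "col_dims N"] A B by (simp add: dims_einstein dims_ctranspose)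
  have BA: "ctranspose N B \<star>\<^bsub>N\<^esub> A = ctranspose N A \<star>\<^bsub>N\<^esub> B"
  proof -
    have "ctranspose N B \<star>\<^bsub>N\<^esub> A = ctranspose N (ctranspose N A \<star>\<^bsub>N\<^esub> B)"
      using A B by (simp add: ctranspose_einstein dims_ctranspose ctranspose_ctranspose)
    also have "\<dots> = ctranspose N (ctranspose N A \<star>\<^bsub>N\<^esub> A)"
      by (simp only: AA)
    also have "\<dots> = ctranspose N A \<star>\<^bsub>N\<^esub> A"
      using A by (simp add: ctranspose_einstein dims_ctranspose ctranspose_ctranspose)
    finally show ?thesis
      by (simp only: AA)
  qed
  fix i j assume i: "i \<in> idx (row_dims N A)" and "j \<in> idx (col_dims N A)"
  then have j: "length j = N"
    using length_split_idx(2)[OF A] by blast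
  let ?d = "\<lambda>k. entry A (k @ j) - entry B (k @ j)"
  have "complex_of_real (\<Sum>k\<in>idx (row_dims N A). (cmod (?d k))\<^sup>2)
      = (\<Sum>k\<in>idx (row_dims N A). cnj (?d k) * ?d k)"
    by (simp only: of_real_sum complex_norm_square mult.commute)
  also have "\<dots> = entry (ctranspose N A \<star>\<^bsub>N\<^esub> A) (j @ j) - entry (ctranspose N A \<star>\<^bsub>N\<^esub> B) (j @ j)
      - entry (ctranspose N B \<star>\<^bsub>N\<^esub> A) (j @ j) + entry (ctranspose N B \<star>\<^bsub>N\<^esub> B) (j @ j)"
    using A B j rows
    by (simp add: entry_gram algebra_simps sum_subtractf sum.distrib)
  also have "\<dots> = 0"
    by (simp add: AA BB BA)
  finally have "(\<Sum>k\<in>idx (row_dims N A). (cmod (?d k))\<^sup>2) = 0"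
    by (simp only: of_real_eq_0_iff)
  then show "entry A (i @ j) = entry B (i @ j)"
    using i by (simp add: sum_nonneg_eq_0_iff)
qed

text \<open>
  The column \<open>i\<close> of \<open>G\<close> is a least squares solution for the unit vector with index \<open>i\<close>.
\<close>

lemma einstein_normal_equation:
  assumes A: "A \<in> even_tensors N"
  shows "\<exists>G\<in>even_tensors N. ctranspose N A \<star>\<^bsub>N\<^esub> (A \<star>\<^bsub>N\<^esub> G) = ctranspose N A"
proof -
  let ?K = "idx (row_dims N A)" and ?L = "idx (col_dims N A)"
  let ?r = "\<lambda>i x l. \<Sum>k\<in>?K. cnj (entry A (k @ l)) *
      ((if k = i then 1 else 0) - (\<Sum>j\<in>?L. entry A (k @ j) * x j))"
  have "\<forall>i. \<exists>x. \<forall>l\<in>?L. ?r i x l = 0"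
    by (intro allI normal_equations_solvable finite_idx)
  then have "\<exists>x. \<forall>i. \<forall>l\<in>?L. ?r i (x i) l = 0"
    by (rule choice)
  then obtain x where x: "\<forall>i. \<forall>l\<in>?L. ?r i (x i) l = 0" ..
  define G where "G = mk_tensor (col_dims N A @ row_dims N A) (\<lambda>ji. x (drop N ji) (take N ji))"
  have G: "G \<in> even_tensors N" and rG: "row_dims N G = col_dims N A" and cG: "col_dims N G = row_dims N A"
    using A by (simp_all add: G_def even_tensors_def)
  have eG: "entry G (j @ i) = x i j" if "j \<in> ?L" "i \<in> ?K" for i j
    using that length_split_idx(2)[OF A that(1)] append_idx_iff[of j "col_dims N A" i "row_dims N A"] A
    by (simp add: G_def entry_mk_tensor length_idx)
  note [simp] = dims_einstein dims_ctranspose A G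
  have "ctranspose N A \<star>\<^bsub>N\<^esub> (A \<star>\<^bsub>N\<^esub> G) = ctranspose N A"
  proof (rule even_tensor_eqI)
    fix l i
    assume "l \<in> idx (row_dims N (ctranspose N A \<star>\<^bsub>N\<^esub> (A \<star>\<^bsub>N\<^esub> G)))"
      and "i \<in> idx (col_dims N (ctranspose N A \<star>\<^bsub>N\<^esub> (A \<star>\<^bsub>N\<^esub> G)))"
    then have l: "l \<in> ?L" and i: "i \<in> ?K"
      by (simp_all add: cG)
    have ll: "length l = N" and li: "length i = N"
      using l i length_split_idx[OF A] by blast+
    have "entry (ctranspose N A \<star>\<^bsub>N\<^esub> (A \<star>\<^bsub>N\<^esub> G)) (l @ i)
        = (\<Sum>k\<in>?K. cnj (entry A (k @ l)) * entry (A \<star>\<^bsub>N\<^esub> G) (k @ i))"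
      using ll by (intro entry_gram) simp_all
    also have "\<dots> = (\<Sum>k\<in>?K. cnj (entry A (k @ l)) * (\<Sum>j\<in>?L. entry A (k @ j) * x i j))"
      using i by (intro sum.cong refl) (simp add: entry_einstein length_split_idx(1)[OF A] eG)
    also have "\<dots> = (\<Sum>k\<in>?K. cnj (entry A (k @ l)) * (if k = i then 1 else 0))"
      using x l by (simp add: right_diff_distrib sum_subtractf)
    also have "\<dots> = entry (ctranspose N A) (l @ i)"
      using i ll li by (simp add: entry_ctranspose if_distrib[of "(*) _"] sum.delta' cong: if_cong)
    finally show "entry (ctranspose N A \<star>\<^bsub>N\<^esub> (A \<star>\<^bsub>N\<^esub> G)) (l @ i) = entry (ctranspose N A) (l @ i)" .
  qed (simp_all add: cG)
  then show ?thesis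
    using G by blast
qed

end

interpretation even_tensors:
  adjoint_semigroup "even_tensors N" "\<lambda>A B. A \<star>\<^bsub>N\<^esub> B" "ctranspose N" "row_dims N" for N
  by unfold_locales
    (simp_all add: dims_einstein dims_ctranspose einstein_assoc ctranspose_ctranspose
      ctranspose_einstein einstein_proper einstein_normal_equation)

text \<open>
  The dimensions prescribed for the inverse already follow from the Penrose equations: a
  self-adjoint product has equal row and column dimensions.
\<close>

lemma is_mp_inverse_iff_mp:
  assumes A: "A \<in> even_tensors N"
  shows "is_mp_inverse N A X \<longleftrightarrow> even_tensors.mp N A X"
proof -
  have "dims X = col_dims N A @ row_dims N A"
    if X: "X \<in> even_tensors N"
      and h: "ctranspose N (A \<star>\<^bsub>N\<^esub> X) = A \<star>\<^bsub>N\<^esub> X" "ctranspose N (X \<star>\<^bsub>N\<^esub> A) = X \<star>\<^bsub>N\<^esub> A"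
  proof -
    have "col_dims N X = row_dims N A"
      using arg_cong[OF h(1), of "row_dims N"] A X by (simp add: dims_einstein dims_ctranspose)
    moreover have "row_dims N X = col_dims N A"
      using arg_cong[OF h(2), of "row_dims N"] A X by (simp add: dims_einstein dims_ctranspose)
    ultimately show ?thesis
      by (metis append_take_drop_id)
  qed
  moreover have "X \<in> even_tensors N" if "dims X = col_dims N A @ row_dims N A"
    using that A by (simp add: even_tensors_def)
  ultimately show ?thesis
    unfolding is_mp_inverse_def even_tensors.mp_def tensors_def by blast
qed

lemma mp_inverse_eq_iff:
  assumes A: "A \<in> even_tensors N"
  shows "mp_inverse N A = X \<longleftrightarrow> even_tensors.mp N A X"
proof -
  obtain Y where Y: "even_tensors.mp N A Y"
    using even_tensors.mp_exists[OF A] .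
  have eq: "mp_inverse N A = Z" if "even_tensors.mp N A Z" for Z
    unfolding mp_inverse_def is_mp_inverse_iff_mp[OF A]
    using that even_tensors.mp_unique[OF A] by (intro the_equality)
  show ?thesis
    using eq Y by blast
qed

theorem theorem3p28:
  fixes N :: nat and I J :: "nat list" and A B :: tensor
  assumes "length I = N" and "length J = N"
    and "A \<in> tensors (I @ J)" and "B \<in> tensors (J @ I)"
  shows "mp_inverse N (A \<star>\<^bsub>N\<^esub> B) = mp_inverse N B \<star>\<^bsub>N\<^esub> mp_inverse N A \<longleftrightarrow>
    mp_inverse N A \<star>\<^bsub>N\<^esub> A \<star>\<^bsub>N\<^esub> B \<star>\<^bsub>N\<^esub> ctranspose N B \<star>\<^bsub>N\<^esub> ctranspose N A
        \<star>\<^bsub>N\<^esub> A \<star>\<^bsub>N\<^esub> B \<star>\<^bsub>N\<^esub> mp_inverse N B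
      = B \<star>\<^bsub>N\<^esub> ctranspose N B \<star>\<^bsub>N\<^esub> ctranspose N A \<star>\<^bsub>N\<^esub> A"
proof -
  have A: "A \<in> even_tensors N" and B: "B \<in> even_tensors N"
    using assms by (simp_all add: tensors_def even_tensors_def)
  have "row_dims N B = row_dims N (ctranspose N A)"
    using assms A by (simp add: tensors_def dims_ctranspose)
  moreover have "even_tensors.mp N A (mp_inverse N A)" "even_tensors.mp N B (mp_inverse N B)"
    using mp_inverse_eq_iff A B by blast+
  ultimately show ?thesis
    unfolding mp_inverse_eq_iff[OF dims_einstein(3)[OF A B]]
    using even_tensors.reverse_order_iff[OF A B] by blast
qed

end
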